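(* (Working in ZF.) Let $X$ be a set such that $X\times X\preceq^* X$. Let $U$ be an ultrafilter over $X$ such that the ultrapower embedding $j_U$ has a critical point $\kappa$, and let $\alpha\ge\kappa$ be an ordinal. If $j_U[\alpha]\in M_U$, then $\alpha\preceq^* X$.
   Context: Write $A\preceq^* B$ if there is a partial surjection from $B$ onto $A$. For an ultrafilter $U$ over $X$, $M_U$ is the ultrapower of $V$ by $U$: its elements are classes $[f]_U$ of functions $f$ with domain $X$ modulo agreement on a $U$-large set, with $[f]_U\in_U[g]_U$ iff $\{x: f(x)\in g(x)\}\in U$, and $j_U(a)=[c_a]_U$ where $c_a$ is the constant function with value $a$ (Łoś's theorem and wellfoundedness are not assumed). The critical point of $j_U$ is the least ordinal $\kappa$ such that some function $f:X\to\kappa$ is not constant on any set in $U$. "$j_U[\alpha]\in M_U$" means there is a function $g$ on $X$ such that for every function $f$ on $X$, $[f]_U\in_U[g]_U$ iff $[f]_U=j_U(\beta)$ for some $\beta<\alpha$. *)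

theory Defs
  imports Main
begin

text \<open>
  ``Working in ZF'' is rendered as truth in every structure \<open>('v, E)\<close> satisfying the first-order
  axioms of ZF.  The Separation and Replacement schemes range over first-order formulas only: if
  they ranged over arbitrary HOL predicates, the choice operator of HOL would force the axiom of
  choice to hold in the structure.
\<close>

datatype fm = Mem nat nat | Eq nat nat | Neg fm | Conj fm fm | All nat fm

primrec sat :: "('v \<Rightarrow> 'v \<Rightarrow> bool) \<Rightarrow> (nat \<Rightarrow> 'v) \<Rightarrow> fm \<Rightarrow> bool" where
  "sat E e (Mem i j) \<longleftrightarrow> E (e i) (e j)"
| "sat E e (Eq i j) \<longleftrightarrow> e i = e j"
| "sat E e (Neg \<phi>) \<longleftrightarrow> \<not> sat E e \<phi>"
| "sat E e (Conj \<phi> \<psi>) \<longleftrightarrow> sat E e \<phi> \<and> sat E e \<psi>"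
| "sat E e (All i \<phi>) \<longleftrightarrow> (\<forall>x. sat E (e(i := x)) \<phi>)"

definition elts :: "('v \<Rightarrow> 'v \<Rightarrow> bool) \<Rightarrow> 'v \<Rightarrow> 'v set" where
  "elts E a = {x. E x a}"

text \<open>In the two schemes the assignment \<open>e\<close> supplies the parameters of the formula.\<close>

locale ZF_model =
  fixes E :: "'v \<Rightarrow> 'v \<Rightarrow> bool"
  assumes extensionality: "elts E a = elts E b \<Longrightarrow> a = b"
    and foundation: "elts E a \<noteq> {} \<Longrightarrow> \<exists>x\<in>elts E a. elts E x \<inter> elts E a = {}"
    and pairing: "\<exists>c. elts E c = {a, b}"
    and union: "\<exists>u. elts E u = (\<Union>x\<in>elts E a. elts E x)"
    and powerset: "\<exists>p. elts E p = {b. elts E b \<subseteq> elts E a}"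
    and infinity: "\<exists>w. (\<exists>z\<in>elts E w. elts E z = {}) \<and>
      (\<forall>x\<in>elts E w. \<exists>y\<in>elts E w. elts E y = insert x (elts E x))"
    and separation: "\<exists>b. elts E b = {x \<in> elts E a. sat E (e(0 := x)) \<phi>}"
    and replacement:
      "(\<And>x y y'. x \<in> elts E a \<Longrightarrow> sat E (e(0 := x, 1 := y)) \<phi> \<Longrightarrow>
          sat E (e(0 := x, 1 := y')) \<phi> \<Longrightarrow> y = y') \<Longrightarrow>
       \<exists>b. elts E b = {y. \<exists>x\<in>elts E a. sat E (e(0 := x, 1 := y)) \<phi>}"

context
  fixes E :: "'v \<Rightarrow> 'v \<Rightarrow> bool"  (infix \<open>\<epsilon>\<close> 50)
begin

text \<open>
  The element of the structure with the given extension; it is applied only to extensions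
  which the axioms of ZF guarantee to be realised by an element.
\<close>

definition set_of :: "'v set \<Rightarrow> 'v" where
  "set_of A = (THE a. elts E a = A)"

definition opair :: "'v \<Rightarrow> 'v \<Rightarrow> 'v" where
  "opair x y = set_of {set_of {x}, set_of {x, y}}"

definition cprod :: "'v \<Rightarrow> 'v \<Rightarrow> 'v" where
  "cprod A B = set_of {opair x y | x y. x \<epsilon> A \<and> y \<epsilon> B}"

definition surj_le :: "'v \<Rightarrow> 'v \<Rightarrow> bool" where
  "surj_le A B \<longleftrightarrow> (\<exists>f.
     (\<forall>p. p \<epsilon> f \<longrightarrow> (\<exists>x y. x \<epsilon> B \<and> y \<epsilon> A \<and> p = opair x y)) \<and>
     (\<forall>x y y'. opair x y \<epsilon> f \<longrightarrow> opair x y' \<epsilon> f \<longrightarrow> y = y') \<and>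
     (\<forall>y. y \<epsilon> A \<longrightarrow> (\<exists>x. opair x y \<epsilon> f)))"

definition fun_on :: "'v \<Rightarrow> 'v \<Rightarrow> bool" where
  "fun_on X f \<longleftrightarrow>
     (\<forall>p. p \<epsilon> f \<longrightarrow> (\<exists>x y. x \<epsilon> X \<and> p = opair x y)) \<and>
     (\<forall>x. x \<epsilon> X \<longrightarrow> (\<exists>!y. opair x y \<epsilon> f))"

definition app :: "'v \<Rightarrow> 'v \<Rightarrow> 'v" where
  "app f x = (THE y. opair x y \<epsilon> f)"

definition const_fun :: "'v \<Rightarrow> 'v \<Rightarrow> 'v" where
  "const_fun X a = set_of {opair x a | x. x \<epsilon> X}"

definition ordinal :: "'v \<Rightarrow> bool" where
  "ordinal \<alpha> \<longleftrightarrow>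
     (\<forall>\<beta>. \<beta> \<epsilon> \<alpha> \<longrightarrow> elts E \<beta> \<subseteq> elts E \<alpha>) \<and>
     (\<forall>\<beta> \<gamma>. \<beta> \<epsilon> \<alpha> \<longrightarrow> \<gamma> \<epsilon> \<alpha> \<longrightarrow> \<beta> \<epsilon> \<gamma> \<or> \<beta> = \<gamma> \<or> \<gamma> \<epsilon> \<beta>) \<and>
     (\<forall>s. elts E s \<subseteq> elts E \<alpha> \<longrightarrow> elts E s \<noteq> {} \<longrightarrow> (\<exists>\<mu>. \<mu> \<epsilon> s \<and> (\<forall>\<beta>. \<beta> \<epsilon> s \<longrightarrow> \<not> \<beta> \<epsilon> \<mu>)))"

definition ord_le :: "'v \<Rightarrow> 'v \<Rightarrow> bool" where
  "ord_le \<alpha> \<beta> \<longleftrightarrow> \<alpha> \<epsilon> \<beta> \<or> \<alpha> = \<beta>"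

definition ultrafilter_over :: "'v \<Rightarrow> 'v \<Rightarrow> bool" where
  "ultrafilter_over X U \<longleftrightarrow>
     (\<forall>A. A \<epsilon> U \<longrightarrow> elts E A \<subseteq> elts E X) \<and>
     X \<epsilon> U \<and>
     (\<forall>A. A \<epsilon> U \<longrightarrow> elts E A \<noteq> {}) \<and>
     (\<forall>A B. A \<epsilon> U \<longrightarrow> elts E A \<subseteq> elts E B \<longrightarrow> elts E B \<subseteq> elts E X \<longrightarrow> B \<epsilon> U) \<and>
     (\<forall>A B. A \<epsilon> U \<longrightarrow> B \<epsilon> U \<longrightarrow> set_of (elts E A \<inter> elts E B) \<epsilon> U) \<and>
     (\<forall>A. elts E A \<subseteq> elts E X \<longrightarrow> A \<epsilon> U \<or> set_of (elts E X - elts E A) \<epsilon> U)"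

text \<open>
  The elements of the ultrapower are proper classes of the structure; they are represented by
  HOL sets of elements of the structure.
\<close>

definition ult_class :: "'v \<Rightarrow> 'v \<Rightarrow> 'v \<Rightarrow> 'v set" where
  "ult_class X U f = {g. fun_on X g \<and> set_of {x \<in> elts E X. app f x = app g x} \<epsilon> U}"

definition ult_mem :: "'v \<Rightarrow> 'v \<Rightarrow> 'v set \<Rightarrow> 'v set \<Rightarrow> bool" where
  "ult_mem X U a b \<longleftrightarrow> (\<exists>f\<in>a. \<exists>g\<in>b. set_of {x \<in> elts E X. app f x \<epsilon> app g x} \<epsilon> U)"

definition ult_embed :: "'v \<Rightarrow> 'v \<Rightarrow> 'v \<Rightarrow> 'v set" where
  "ult_embed X U a = ult_class X U (const_fun X a)"

definition has_nonconstant_fun :: "'v \<Rightarrow> 'v \<Rightarrow> 'v \<Rightarrow> bool" where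
  "has_nonconstant_fun X U \<kappa> \<longleftrightarrow>
     (\<exists>f. fun_on X f \<and> (\<forall>x. x \<epsilon> X \<longrightarrow> app f x \<epsilon> \<kappa>) \<and>
       \<not> (\<exists>A c. A \<epsilon> U \<and> (\<forall>x. x \<epsilon> A \<longrightarrow> app f x = c)))"

definition critical_point :: "'v \<Rightarrow> 'v \<Rightarrow> 'v \<Rightarrow> bool" where
  "critical_point X U \<kappa> \<longleftrightarrow>
     ordinal \<kappa> \<and> has_nonconstant_fun X U \<kappa> \<and>
     (\<forall>\<mu>. ordinal \<mu> \<longrightarrow> has_nonconstant_fun X U \<mu> \<longrightarrow> ord_le \<kappa> \<mu>)"

text \<open>The pointwise image of \<open>\<alpha>\<close> under the ultrapower embedding belongs to the ultrapower.\<close>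

definition image_in_ultrapower :: "'v \<Rightarrow> 'v \<Rightarrow> 'v \<Rightarrow> bool" where
  "image_in_ultrapower X U \<alpha> \<longleftrightarrow>
     (\<exists>g. fun_on X g \<and>
       (\<forall>f. fun_on X f \<longrightarrow>
         (ult_mem X U (ult_class X U f) (ult_class X U g) \<longleftrightarrow>
          (\<exists>\<beta>. \<beta> \<epsilon> \<alpha> \<and> ult_class X U f = ult_embed X U \<beta>))))"

end

end

theory Submission
  imports Defs
begin

text \<open>
  Let \<open>f : X \<rightarrow> \<kappa>\<close> be constant on no set in \<open>U\<close> and let \<open>g\<close> represent \<open>j[\<alpha>]\<close>.  Define a partial
  function \<open>e\<close> from \<open>X\<close> to \<open>\<alpha>\<close> by recursion along \<open>f\<close>: \<open>e(x)\<close> is the least element of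
  \<open>g(x) \<inter> \<alpha>\<close> different from all \<open>e(y)\<close> with \<open>f(y) < f(x)\<close>, if there is one.  If \<open>dom e \<in> U\<close>, then
  \<open>[e] \<in> [g] = j[\<alpha>]\<close>, so \<open>e\<close> is constant on a set in \<open>U\<close>, and \<open>f\<close> is constant there too because \<open>e\<close>
  takes different values at points where \<open>f\<close> does.  So the complement of \<open>dom e\<close> is in \<open>U\<close>.
  Every \<open>\<beta> < \<alpha>\<close> lies in \<open>g(x)\<close> for \<open>U\<close>-many \<open>x\<close>, hence for some \<open>x \<notin> dom e\<close>, and this means that \<open>\<beta>\<close>
  is a value of \<open>e\<close>.  So \<open>e\<close> is onto \<open>\<alpha>\<close>.
\<close>

section \<open>First-order formulas\<close>

definition fDisj :: "fm \<Rightarrow> fm \<Rightarrow> fm" where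
  "fDisj \<phi> \<psi> = Neg (Conj (Neg \<phi>) (Neg \<psi>))"

definition fIff :: "fm \<Rightarrow> fm \<Rightarrow> fm" where
  "fIff \<phi> \<psi> = Conj (Neg (Conj \<phi> (Neg \<psi>))) (Neg (Conj \<psi> (Neg \<phi>)))"

definition fEx :: "nat \<Rightarrow> fm \<Rightarrow> fm" where
  "fEx i \<phi> = Neg (All i (Neg \<phi>))"

lemma sat_fDisj [simp]: "sat E e (fDisj \<phi> \<psi>) \<longleftrightarrow> sat E e \<phi> \<or> sat E e \<psi>"
  by (simp add: fDisj_def)

lemma sat_fIff [simp]: "sat E e (fIff \<phi> \<psi>) \<longleftrightarrow> (sat E e \<phi> \<longleftrightarrow> sat E e \<psi>)"
  by (auto simp: fIff_def)

lemma sat_fEx [simp]: "sat E e (fEx i \<phi>) \<longleftrightarrow> (\<exists>x. sat E (e(i := x)) \<phi>)"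
  by (simp add: fEx_def)

text \<open>
  Substitution is not capture-avoiding: the arguments of a formula abbreviation must be smaller
  than the variables that it binds.
\<close>

definition fPair :: "nat \<Rightarrow> nat \<Rightarrow> nat \<Rightarrow> fm" where
  "fPair p i j = fEx 100 (fEx 101
     (Conj (All 102 (fIff (Mem 102 100) (Eq 102 i)))
     (Conj (All 102 (fIff (Mem 102 101) (fDisj (Eq 102 i) (Eq 102 j))))
           (All 102 (fIff (Mem 102 p) (fDisj (Eq 102 100) (Eq 102 101)))))))"

definition fRel :: "nat \<Rightarrow> nat \<Rightarrow> nat \<Rightarrow> fm" where
  "fRel r i j = fEx 99 (Conj (fPair 99 i j) (Mem 99 r))"

section \<open>Sets and relations in a model of ZF\<close>

context ZF_model
begin

abbreviation rel :: "'v \<Rightarrow> 'v \<Rightarrow> 'v \<Rightarrow> bool" where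
  "rel r x y \<equiv> E (opair E x y) r"

lemma in_elts [simp]: "x \<in> elts E a \<longleftrightarrow> E x a"
  by (simp add: elts_def)

lemma set_of_elts [simp]: "set_of E (elts E a) = a"
  unfolding set_of_def by (rule the_equality) (auto intro: extensionality)

lemma elts_set_of: "elts E a = A \<Longrightarrow> elts E (set_of E A) = A"
  by auto

lemma elts_single [simp]: "elts E (set_of E {x}) = {x}"
  using pairing[of x x] elts_set_of[of _ "{x}"] by auto

lemma elts_pair [simp]: "elts E (set_of E {x, y}) = {x, y}"
  using pairing[of x y] elts_set_of[of _ "{x, y}"] by auto

lemma elts_opair: "elts E (opair E x y) = {set_of E {x}, set_of E {x, y}}"
  by (simp add: opair_def)

lemma set_of_pair_eq_iff: "set_of E {x, y} = set_of E {u, v} \<longleftrightarrow> {x, y} = {u, v}"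
  by (metis elts_pair)

lemma opair_inject [simp]: "opair E x y = opair E u v \<longleftrightarrow> x = u \<and> y = v"
proof
  assume "opair E x y = opair E u v"
  \<comment> \<open>Writing {x} as {x, x} makes both levels unordered pairs, so one criterion for
    equality of doubletons handles inner and outer sets.\<close>
  then have "set_of E {set_of E {x, x}, set_of E {x, y}}
    = set_of E {set_of E {u, u}, set_of E {u, v}}"
    by (simp add: opair_def)
  then show "x = u \<and> y = v"
    unfolding set_of_pair_eq_iff doubleton_eq_iff by auto
qed simp

text \<open>Formulas have no terms for pairs. The right-hand side is what \<open>fPair\<close>
  expresses: the Kuratowski pair with {x} and {x, y} replaced by witnesses a and b.\<close>

lemma eq_opair_iff:
  "p = opair E x y \<longleftrightarrow> (\<exists>a b. (\<forall>z. E z a \<longleftrightarrow> z = x) \<and> (\<forall>z. E z b \<longleftrightarrow> z = x \<or> z = y)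
     \<and> (\<forall>z. E z p \<longleftrightarrow> z = a \<or> z = b))" (is "?L \<longleftrightarrow> ?R")
proof
  assume ?L
  then have "elts E p = {set_of E {x}, set_of E {x, y}}"
    by (simp add: elts_opair)
  moreover have "elts E (set_of E {x}) = {x}" "elts E (set_of E {x, y}) = {x, y}"
    by simp_all
  ultimately show ?R
    unfolding elts_def set_eq_iff by (intro exI[of _ "set_of E {x}"] exI[of _ "set_of E {x, y}"]) auto
next
  assume ?R
  then obtain a b where ab: "elts E a = {x}" "elts E b = {x, y}" "elts E p = {a, b}"
    unfolding elts_def set_eq_iff by auto
  then have "a = set_of E {x}" "b = set_of E {x, y}"
    by (metis set_of_elts)+
  then show ?L
    using ab(3) by (metis opair_def set_of_elts)
qed

lemma sat_fPair [simp]: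
  "\<lbrakk>p < 100; i < 100; j < 100\<rbrakk> \<Longrightarrow> sat E e (fPair p i j) \<longleftrightarrow> e p = opair E (e i) (e j)"
  by (simp add: fPair_def eq_opair_iff)

lemma sat_fRel [simp]:
  "\<lbrakk>r < 99; i < 99; j < 99\<rbrakk> \<Longrightarrow> sat E e (fRel r i j) \<longleftrightarrow> rel (e r) (e i) (e j)"
  by (simp add: fRel_def)

text \<open>A Kuratowski pair with entries in A and B belongs to the double power set of their
  union, and being such a pair is definable, so Separation applies.\<close>

lemma ex_cprod: "\<exists>c. elts E c = {opair E x y | x y. E x A \<and> E y B}"
proof -
  obtain u where u: "elts E u = elts E A \<union> elts E B"
    using union[of "set_of E {A, B}"] by auto
  obtain P where P: "elts E P = {b. elts E b \<subseteq> elts E u}"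
    using powerset by blast
  obtain Q where Q: "elts E Q = {b. elts E b \<subseteq> elts E P}"
    using powerset by blast
  have "opair E x y \<in> elts E Q" if "E x A" "E y B" for x y
    unfolding Q using that by (simp add: elts_opair P u)
  moreover obtain c where "elts E c = {p \<in> elts E Q. sat E ((\<lambda>_. A)(1 := A, 2 := B, 0 := p))
      (fEx 3 (fEx 4 (Conj (Mem 3 1) (Conj (Mem 4 2) (fPair 0 3 4)))))}"
    using separation by blast
  ultimately show ?thesis
    by (intro exI[of _ c]) auto
qed

lemma elts_cprod: "elts E (cprod E A B) = {opair E x y | x y. E x A \<and> E y B}"
  unfolding cprod_def using ex_cprod elts_set_of by blast

lemma ex_Int: "\<exists>c. elts E c = elts E A \<inter> elts E B"
  using separation[of A "\<lambda>_. B" "Mem 0 1"] by (auto simp: Int_def)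

lemma ex_Diff: "\<exists>c. elts E c = elts E A - elts E B"
  using separation[of A "\<lambda>_. B" "Neg (Mem 0 1)"] by (auto simp: set_diff_eq)

lemma mem_asym: "E a b \<Longrightarrow> \<not> E b a"
  using foundation[of "set_of E {a, b}"] by auto

lemma mem_no_3_cycle: "\<lbrakk>E a b; E b c\<rbrakk> \<Longrightarrow> \<not> E c a"
proof -
  obtain s where "elts E s = {a, b, c}"
    using union[of "set_of E {set_of E {a, b}, set_of E {c}}"] by auto
  then show "\<lbrakk>E a b; E b c\<rbrakk> \<Longrightarrow> \<not> E c a"
    using foundation[of s] by auto
qed

section \<open>Ordinals of the model\<close>

lemma ordinal_trans: "\<lbrakk>ordinal E \<kappa>; E b \<kappa>; E a b\<rbrakk> \<Longrightarrow> E a \<kappa>"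
  unfolding ordinal_def by (meson in_elts subsetD)

lemma ordinal_linear: "\<lbrakk>ordinal E \<kappa>; E a \<kappa>; E b \<kappa>\<rbrakk> \<Longrightarrow> E a b \<or> a = b \<or> E b a"
  unfolding ordinal_def by auto

text \<open>Inside \<kappa> the elements a and c are comparable, and both a = c and c \<in> a would
  create a membership cycle, which Foundation forbids.\<close>

lemma ordinal_elem_trans: "\<lbrakk>ordinal E \<kappa>; E c \<kappa>; E b c; E a b\<rbrakk> \<Longrightarrow> E a c"
  by (metis mem_asym mem_no_3_cycle ordinal_linear ordinal_trans)

text \<open>This is transfinite induction on an ordinal. The definition of \<open>ordinal\<close>
  gives least elements only for subsets lying in the model, so the property must be a formula for
  Separation to realise it. Transitivity of \<kappa> makes m minimal among all b, not only those in
  \<kappa>.\<close>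

lemma ordinal_least:
  assumes "ordinal E \<kappa>" and "E a \<kappa>" and "sat E (e(0 := a)) \<phi>"
  obtains m where "E m \<kappa>" and "sat E (e(0 := m)) \<phi>"
    and "\<And>b. E b m \<Longrightarrow> \<not> sat E (e(0 := b)) \<phi>"
proof -
  obtain s where s: "elts E s = {x \<in> elts E \<kappa>. sat E (e(0 := x)) \<phi>}"
    using separation by blast
  then have "elts E s \<subseteq> elts E \<kappa>" "elts E s \<noteq> {}"
    using assms by auto
  then obtain m where "E m s" and least: "\<And>b. E b s \<Longrightarrow> \<not> E b m"
    using assms(1) unfolding ordinal_def by metis
  then have "E m \<kappa>" "sat E (e(0 := m)) \<phi>"
    using s unfolding elts_def by auto
  moreover have "\<not> sat E (e(0 := b)) \<phi>" if "E b m" for b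
    using least[of b] that s ordinal_trans[OF assms(1) \<open>E m \<kappa>\<close> that] unfolding elts_def by auto
  ultimately show ?thesis
    using that by blast
qed

section \<open>Functions of the model\<close>

lemma app_eq:
  assumes "fun_on E X f" and "E x X"
  shows "app E f x = y \<longleftrightarrow> rel f x y"
proof -
  have "\<exists>!y. rel f x y"
    using assms unfolding fun_on_def by blast
  then show ?thesis
    unfolding app_def by (metis theI')
qed

lemma fun_on_domain: "\<lbrakk>fun_on E X f; rel f x y\<rbrakk> \<Longrightarrow> E x X"
  unfolding fun_on_def by fastforce

lemma elts_const_fun: "elts E (const_fun E X a) = {opair E x a | x. E x X}"
proof -
  have "elts E (cprod E X (set_of E {a})) = {opair E x a | x. E x X}"
    using elts_single[of a] unfolding elts_cprod set_eq_iff in_elts by auto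
  then show ?thesis
    unfolding const_fun_def by (rule elts_set_of)
qed

lemma rel_const_fun: "rel (const_fun E X a) x y \<longleftrightarrow> E x X \<and> y = a"
  using elts_const_fun[of X a] unfolding elts_def set_eq_iff by auto

lemma fun_on_const_fun: "fun_on E X (const_fun E X a)"
proof -
  have "\<exists>x y. E x X \<and> p = opair E x y" if "E p (const_fun E X a)" for p
    using elts_const_fun[of X a] that unfolding elts_def by blast
  then show ?thesis
    unfolding fun_on_def rel_const_fun by blast
qed

lemma app_const_fun: "E x X \<Longrightarrow> app E (const_fun E X a) x = a"
  by (simp add: app_eq[OF fun_on_const_fun] rel_const_fun)

text \<open>\<open>set_of\<close> is meaningful only for an extension that the model realises.
  Agreement is definable from the graphs of f and g, so Separation provides the set.\<close>

lemma elts_eq_locus: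
  assumes "fun_on E X f" "fun_on E X g"
  shows "elts E (set_of E {x \<in> elts E X. app E f x = app E g x}) = {x. E x X \<and> app E f x = app E g x}"
proof -
  obtain s where "elts E s = {x \<in> elts E X. sat E ((\<lambda>_. f)(1 := f, 2 := g, 0 := x))
      (fEx 3 (Conj (fRel 1 0 3) (fRel 2 0 3)))}"
    using separation by blast
  then have "elts E s = {x \<in> elts E X. app E f x = app E g x}"
    using app_eq[OF assms(1)] app_eq[OF assms(2)] by force
  from elts_set_of[OF this] show ?thesis by simp
qed

lemma elts_mem_locus:
  assumes "fun_on E X f" "fun_on E X g"
  shows "elts E (set_of E {x \<in> elts E X. E (app E f x) (app E g x)})
    = {x. E x X \<and> E (app E f x) (app E g x)}"
proof -
  obtain s where "elts E s = {x \<in> elts E X. sat E ((\<lambda>_. f)(1 := f, 2 := g, 0 := x))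
      (fEx 3 (fEx 4 (Conj (fRel 1 0 3) (Conj (fRel 2 0 4) (Mem 3 4)))))}"
    using separation by blast
  then have "elts E s = {x \<in> elts E X. E (app E f x) (app E g x)}"
    using app_eq[OF assms(1)] app_eq[OF assms(2)] by force
  from elts_set_of[OF this] show ?thesis by simp
qed

section \<open>Ultrafilters\<close>

lemma ultrafilter_subset: "\<lbrakk>ultrafilter_over E X U; E A U\<rbrakk> \<Longrightarrow> elts E A \<subseteq> elts E X"
  by (simp add: ultrafilter_over_def)

lemma ultrafilter_mono:
  "\<lbrakk>ultrafilter_over E X U; E A U; elts E A \<subseteq> elts E B; elts E B \<subseteq> elts E X\<rbrakk> \<Longrightarrow> E B U"
  unfolding ultrafilter_over_def by blast

lemma ultrafilter_Int:
  assumes "ultrafilter_over E X U" "E A U" "E B U"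
  obtains C where "E C U" "elts E C = elts E A \<inter> elts E B"
proof -
  have "E (set_of E (elts E A \<inter> elts E B)) U"
    using assms unfolding ultrafilter_over_def by blast
  moreover have "elts E (set_of E (elts E A \<inter> elts E B)) = elts E A \<inter> elts E B"
    using ex_Int elts_set_of by blast
  ultimately show ?thesis using that by blast
qed

lemma ultrafilter_nonempty:
  assumes "ultrafilter_over E X U" "E A U"
  obtains x where "E x A"
proof -
  have "elts E A \<noteq> {}"
    using assms by (simp add: ultrafilter_over_def)
  then show ?thesis using that unfolding elts_def by blast
qed

lemma ultrafilter_cases:
  assumes "ultrafilter_over E X U" "elts E A \<subseteq> elts E X"
  obtains "E A U" | B where "E B U" "elts E B = elts E X - elts E A"
proof -
  have "E A U \<or> E (set_of E (elts E X - elts E A)) U"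
    using assms unfolding ultrafilter_over_def by blast
  moreover have "elts E (set_of E (elts E X - elts E A)) = elts E X - elts E A"
    using ex_Diff elts_set_of by blast
  ultimately show ?thesis using that by blast
qed

section \<open>Membership in the ultrapower\<close>

lemma ult_class_refl:
  assumes "ultrafilter_over E X U" "fun_on E X f"
  shows "f \<in> ult_class E X U f"
proof -
  have "E X U"
    using assms(1) unfolding ultrafilter_over_def by blast
  then show ?thesis
    using assms(2) set_of_elts[of X] unfolding ult_class_def elts_def by simp
qed

text \<open>The constant function with value \<beta> represents j(\<beta>), an element of [g].
  Membership of classes is witnessed by some representatives h and k, so A is the intersection of
  three sets: where h takes the value \<beta>, where k agrees with g, and where h(x) \<in>
  k(x).\<close>

lemma image_covers:
  assumes U: "ultrafilter_over E X U" and g: "fun_on E X g"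
    and img: "\<And>f. fun_on E X f \<Longrightarrow> ult_mem E X U (ult_class E X U f) (ult_class E X U g) \<longleftrightarrow>
        (\<exists>\<beta>. E \<beta> \<alpha> \<and> ult_class E X U f = ult_embed E X U \<beta>)"
    and \<beta>: "E \<beta> \<alpha>"
  obtains A where "E A U" "\<And>x. E x A \<Longrightarrow> E x X \<and> E \<beta> (app E g x)"
proof -
  let ?c = "const_fun E X \<beta>"
  have "ult_mem E X U (ult_class E X U ?c) (ult_class E X U g)"
    using img[OF fun_on_const_fun] \<beta> unfolding ult_embed_def by blast
  then obtain h k where h: "fun_on E X h" "E (set_of E {x \<in> elts E X. app E ?c x = app E h x}) U"
    and k: "fun_on E X k" "E (set_of E {x \<in> elts E X. app E g x = app E k x}) U"
    and hk: "E (set_of E {x \<in> elts E X. E (app E h x) (app E k x)}) U"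
    unfolding ult_mem_def ult_class_def by auto
  obtain B where B: "E B U" "elts E B =
      {x. E x X \<and> app E ?c x = app E h x} \<inter> {x. E x X \<and> app E g x = app E k x}"
    using ultrafilter_Int[OF U h(2) k(2), unfolded elts_eq_locus[OF fun_on_const_fun h(1)]
      elts_eq_locus[OF g k(1)]] by blast
  obtain A where A: "E A U" "elts E A = elts E B \<inter> {x. E x X \<and> E (app E h x) (app E k x)}"
    using ultrafilter_Int[OF U B(1) hk, unfolded elts_mem_locus[OF h(1) k(1)]] by blast
  have "E x X \<and> E \<beta> (app E g x)" if "E x A" for x
  proof -
    have "x \<in> elts E A" using that by simp
    then show ?thesis
      unfolding A(2) B(2) using app_const_fun by auto
  qed
  with A(1) show ?thesis using that by blast
qed

text \<open>Selecting from g on a set in U makes [h] an element of [g] = j[\<alpha>], so [h] =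
  j(\<beta>) for some \<beta>. Then h lies in the class of a constant function, which means
  agreement with it on a set in U.\<close>

lemma selector_constant:
  assumes U: "ultrafilter_over E X U" and g: "fun_on E X g"
    and img: "\<And>f. fun_on E X f \<Longrightarrow> ult_mem E X U (ult_class E X U f) (ult_class E X U g) \<longleftrightarrow>
        (\<exists>\<beta>. E \<beta> \<alpha> \<and> ult_class E X U f = ult_embed E X U \<beta>)"
    and h: "fun_on E X h" and D: "E D U" "\<And>x. E x D \<Longrightarrow> E (app E h x) (app E g x)"
  obtains A \<beta> where "E A U" "\<And>x. E x A \<Longrightarrow> E x X \<and> app E h x = \<beta>"
proof -
  let ?M = "set_of E {x \<in> elts E X. E (app E h x) (app E g x)}"
  have "elts E D \<subseteq> elts E ?M" "elts E ?M \<subseteq> elts E X"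
    unfolding elts_mem_locus[OF h g] using D(2) ultrafilter_subset[OF U D(1)] by auto
  then have "E ?M U"
    using ultrafilter_mono[OF U D(1)] by blast
  then have "ult_mem E X U (ult_class E X U h) (ult_class E X U g)"
    unfolding ult_mem_def using ult_class_refl[OF U] h g by blast
  then obtain \<beta> where "ult_class E X U h = ult_embed E X U \<beta>"
    using img[OF h] by blast
  then have "h \<in> ult_class E X U (const_fun E X \<beta>)"
    using ult_class_refl[OF U h] unfolding ult_embed_def by simp
  then have "E (set_of E {x \<in> elts E X. app E (const_fun E X \<beta>) x = app E h x}) U" (is "E ?A U")
    unfolding ult_class_def by blast
  moreover have "E x X \<and> app E h x = \<beta>" if "E x ?A" for x
  proof -
    have "x \<in> elts E ?A" using that by simp
    then show ?thesis
      unfolding elts_eq_locus[OF fun_on_const_fun h] using app_const_fun by auto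
  qed
  ultimately show ?thesis using that by blast
qed

end

section \<open>The recursion\<close>

locale greedy_choice = ZF_model +
  fixes X \<kappa> \<alpha> f g :: 'a
  assumes ordinal_\<kappa>: "ordinal E \<kappa>" and ordinal_\<alpha>: "ordinal E \<alpha>"
    and fun_f: "fun_on E X f" and range_f: "\<And>x u. rel f x u \<Longrightarrow> E u \<kappa>"
begin

text \<open>The notions of the recursion use the graphs of f and g instead of \<open>app\<close>, so
  that each can be matched by a first-order formula.\<close>

definition below :: "'a \<Rightarrow> 'a \<Rightarrow> bool" where
  "below x \<xi> \<longleftrightarrow> (\<exists>u. rel f x u \<and> E u \<xi>)"

definition lower :: "'a \<Rightarrow> 'a \<Rightarrow> bool" where
  "lower y x \<longleftrightarrow> (\<exists>v. rel f x v \<and> below y v)"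

text \<open>Members of g(x) can be arbitrary sets; cutting down to \<alpha> makes it possible to
  speak of a least one.\<close>

definition candidate :: "'a \<Rightarrow> 'a \<Rightarrow> bool" where
  "candidate x \<beta> \<longleftrightarrow> E x X \<and> E \<beta> \<alpha> \<and> (\<exists>u. rel g x u \<and> E \<beta> u)"

text \<open>Only points with strictly smaller f-value block a candidate. Points with equal f-value
  may share a value.\<close>

definition least_unused :: "'a \<Rightarrow> 'a \<Rightarrow> 'a \<Rightarrow> bool" where
  "least_unused t x \<beta> \<longleftrightarrow> candidate x \<beta> \<and> \<not> (\<exists>y. lower y x \<and> rel t y \<beta>) \<and>
     \<not> (\<exists>\<gamma>. E \<gamma> \<beta> \<and> candidate x \<gamma> \<and> \<not> (\<exists>y. lower y x \<and> rel t y \<gamma>))"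

text \<open>The recursion equation restricted to points with f-value below \<xi>. Only the pairs in
  t are constrained, so approximations are compared through \<open>rel\<close> and not as
  sets.\<close>

definition approx :: "'a \<Rightarrow> 'a \<Rightarrow> bool" where
  "approx t \<xi> \<longleftrightarrow> (\<forall>x \<beta>. rel t x \<beta> \<longleftrightarrow> below x \<xi> \<and> least_unused t x \<beta>)"

text \<open>In the following formulas the variables 1, 2, 3, 4 stand for \<open>X\<close>, \<open>\<alpha>\<close>, \<open>f\<close>, \<open>g\<close>.\<close>

definition env :: "'a \<Rightarrow> 'a \<Rightarrow> 'a \<Rightarrow> 'a \<Rightarrow> nat \<Rightarrow> 'a" where
  "env a b c d = (\<lambda>_. X)(2 := \<alpha>, 3 := f, 4 := g, 5 := a, 6 := b, 7 := c, 8 := d)"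

text \<open>Binding a variable outside 1 to 4 preserves this condition, so the \<open>sat\<close>
  rules below also apply under quantifiers.\<close>

definition std_env :: "(nat \<Rightarrow> 'a) \<Rightarrow> bool" where
  "std_env e \<longleftrightarrow> e 1 = X \<and> e 2 = \<alpha> \<and> e 3 = f \<and> e 4 = g"

text \<open>Each abbreviation binds smaller variables than the abbreviations it is built from, which
  prevents capture.\<close>

definition fBelow :: "nat \<Rightarrow> nat \<Rightarrow> fm" where
  "fBelow i k = fEx 90 (Conj (fRel 3 i 90) (Mem 90 k))"

definition fLower :: "nat \<Rightarrow> nat \<Rightarrow> fm" where
  "fLower i j = fEx 80 (Conj (fRel 3 j 80) (fBelow i 80))"

definition fCandidate :: "nat \<Rightarrow> nat \<Rightarrow> fm" where
  "fCandidate i j = Conj (Mem i 1) (Conj (Mem j 2) (fEx 80 (Conj (fRel 4 i 80) (Mem j 80))))"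

definition fUsed :: "nat \<Rightarrow> nat \<Rightarrow> nat \<Rightarrow> fm" where
  "fUsed t i j = fEx 70 (Conj (fLower 70 i) (fRel t 70 j))"

definition fLeastUnused :: "nat \<Rightarrow> nat \<Rightarrow> nat \<Rightarrow> fm" where
  "fLeastUnused t i j = Conj (fCandidate i j) (Conj (Neg (fUsed t i j))
     (Neg (fEx 60 (Conj (Mem 60 j) (Conj (fCandidate i 60) (Neg (fUsed t i 60)))))))"

definition fApprox :: "nat \<Rightarrow> nat \<Rightarrow> fm" where
  "fApprox t k = All 50 (All 51 (fIff (fRel t 50 51) (Conj (fBelow 50 k) (fLeastUnused t 50 51))))"

lemma std_env_upd [simp]: "\<lbrakk>std_env e; i < 1 \<or> 4 < i\<rbrakk> \<Longrightarrow> std_env (e(i := x))"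
  by (auto simp: std_env_def)

lemma std_env_env [simp]: "std_env (env a b c d)"
  by (simp add: std_env_def env_def)

lemma env_simps [simp]:
  "env a b c d 3 = f" "env a b c d 5 = a" "env a b c d 6 = b" "env a b c d 7 = c" "env a b c d 8 = d"
  by (simp_all add: env_def)

lemma sat_fBelow [simp]:
  "\<lbrakk>std_env e; i < 90; k < 90\<rbrakk> \<Longrightarrow> sat E e (fBelow i k) \<longleftrightarrow> below (e i) (e k)"
  by (simp add: fBelow_def below_def std_env_def)

lemma sat_fLower [simp]:
  "\<lbrakk>std_env e; i < 80; j < 80\<rbrakk> \<Longrightarrow> sat E e (fLower i j) \<longleftrightarrow> lower (e i) (e j)"
  by (simp add: fLower_def lower_def) (simp add: std_env_def)

lemma sat_fCandidate [simp]:
  "\<lbrakk>std_env e; i < 80; j < 80\<rbrakk> \<Longrightarrow> sat E e (fCandidate i j) \<longleftrightarrow> candidate (e i) (e j)"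
  by (simp add: fCandidate_def candidate_def std_env_def)

lemma sat_fUsed [simp]:
  "\<lbrakk>std_env e; t < 70; i < 70; j < 70\<rbrakk> \<Longrightarrow>
     sat E e (fUsed t i j) \<longleftrightarrow> (\<exists>y. lower y (e i) \<and> rel (e t) y (e j))"
  by (simp add: fUsed_def)

lemma sat_fLeastUnused [simp]:
  "\<lbrakk>std_env e; t < 60; i < 60; j < 60\<rbrakk> \<Longrightarrow>
     sat E e (fLeastUnused t i j) \<longleftrightarrow> least_unused (e t) (e i) (e j)"
  by (simp add: fLeastUnused_def least_unused_def)

lemma sat_fApprox [simp]:
  "\<lbrakk>std_env e; t < 50; k < 50\<rbrakk> \<Longrightarrow> sat E e (fApprox t k) \<longleftrightarrow> approx (e t) (e k)"
  by (simp add: fApprox_def approx_def)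

section \<open>Existence of the recursively defined function\<close>

lemma rel_f_unique: "\<lbrakk>rel f x u; rel f x v\<rbrakk> \<Longrightarrow> u = v"
  using app_eq[OF fun_f] fun_on_domain[OF fun_f] by metis

lemma least_unused_cong:
  "(\<And>y \<beta>. lower y x \<Longrightarrow> rel t y \<beta> \<longleftrightarrow> rel s y \<beta>) \<Longrightarrow> least_unused t x \<beta> \<longleftrightarrow> least_unused s x \<beta>"
  unfolding least_unused_def by blast

text \<open>At a least level \<zeta> of disagreement, all points of lower level agree. Transitivity
  of \<eta> and \<theta> keeps these levels in both, so the recursion equation forces agreement at
  \<zeta> as well.\<close>

lemma approx_agree:
  assumes t: "approx t \<eta>" and s: "approx s \<theta>"
    and \<eta>: "\<And>a b. \<lbrakk>E b \<eta>; E a b\<rbrakk> \<Longrightarrow> E a \<eta>" and \<theta>: "\<And>a b. \<lbrakk>E b \<theta>; E a b\<rbrakk> \<Longrightarrow> E a \<theta>"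
    and z: "below z \<eta>" "below z \<theta>"
  shows "rel t z \<beta> \<longleftrightarrow> rel s z \<beta>"
proof (rule ccontr)
  let ?e = "env t s \<eta> \<theta>"
  let ?\<phi> = "Conj (Mem 0 7) (Conj (Mem 0 8) (fEx 9 (Conj (fRel 3 9 0)
    (fEx 10 (Neg (fIff (fRel 5 9 10) (fRel 6 9 10)))))))"
  have sat: "sat E (?e(0 := \<zeta>)) ?\<phi> \<longleftrightarrow>
      E \<zeta> \<eta> \<and> E \<zeta> \<theta> \<and> (\<exists>z. rel f z \<zeta> \<and> (\<exists>\<beta>. \<not> (rel t z \<beta> \<longleftrightarrow> rel s z \<beta>)))" for \<zeta>
    by simp
  assume neq: "\<not> (rel t z \<beta> \<longleftrightarrow> rel s z \<beta>)"
  obtain \<zeta>' where \<zeta>': "rel f z \<zeta>'" "E \<zeta>' \<eta>" "E \<zeta>' \<theta>"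
    using z rel_f_unique unfolding below_def by blast
  then have "sat E (?e(0 := \<zeta>')) ?\<phi>"
    unfolding sat using neq by blast
  then obtain \<zeta> where \<zeta>: "sat E (?e(0 := \<zeta>)) ?\<phi>"
    and least: "\<And>b. E b \<zeta> \<Longrightarrow> \<not> sat E (?e(0 := b)) ?\<phi>"
    using ordinal_least[OF ordinal_\<kappa> range_f[OF \<zeta>'(1)]] by blast
  obtain w \<gamma> where "E \<zeta> \<eta>" "E \<zeta> \<theta>" and w: "rel f w \<zeta>" "\<not> (rel t w \<gamma> \<longleftrightarrow> rel s w \<gamma>)"
    using \<zeta> unfolding sat by blast
  have "rel t y \<delta> \<longleftrightarrow> rel s y \<delta>" if y: "lower y w" for y \<delta>
  proof -
    obtain \<upsilon> where "rel f y \<upsilon>" "E \<upsilon> \<zeta>"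
      using y w(1) rel_f_unique unfolding lower_def below_def by blast
    then show ?thesis
      using least[of \<upsilon>] \<eta>[OF \<open>E \<zeta> \<eta>\<close>] \<theta>[OF \<open>E \<zeta> \<theta>\<close>] unfolding sat by blast
  qed
  then have "least_unused t w \<gamma> \<longleftrightarrow> least_unused s w \<gamma>"
    by (rule least_unused_cong)
  moreover have "below w \<eta>" "below w \<theta>"
    using w(1) \<open>E \<zeta> \<eta>\<close> \<open>E \<zeta> \<theta>\<close> unfolding below_def by blast+
  ultimately show False
    using t s w(2) unfolding approx_def by blast
qed

text \<open>The value at x is read off from any approximation up to f(x), so successor and limit
  stages need no distinction. No approximations have to be chosen, because any two agree where both
  are defined. Stating this for transitive subsets of \<kappa> covers both \<xi> \<in> \<kappa> and
  \<xi> = \<kappa>.\<close>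

lemma approx_step:
  assumes sub: "\<And>a. E a \<xi> \<Longrightarrow> E a \<kappa>" and trans: "\<And>a b. \<lbrakk>E b \<xi>; E a b\<rbrakk> \<Longrightarrow> E a \<xi>"
    and ex: "\<And>\<eta>. E \<eta> \<xi> \<Longrightarrow> \<exists>s. approx s \<eta>"
  shows "\<exists>t. approx t \<xi> \<and> elts E t \<subseteq> elts E (cprod E X \<alpha>)"
proof -
  obtain t where t: "elts E t = {p \<in> elts E (cprod E X \<alpha>). sat E ((env \<xi> \<xi> \<xi> \<xi>)(0 := p))
    (fEx 9 (fEx 10 (fEx 11 (fEx 12 (Conj (fPair 0 9 10) (Conj (fRel 3 9 11) (Conj (Mem 11 5)
      (Conj (fApprox 12 11) (fLeastUnused 12 9 10)))))))))}"
    using separation by blast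
  have rel_t: "rel t x \<beta> \<longleftrightarrow>
      (\<exists>\<eta> s. rel f x \<eta> \<and> E \<eta> \<xi> \<and> approx s \<eta> \<and> least_unused s x \<beta>)" for x \<beta>
  proof -
    have "rel t x \<beta> \<longleftrightarrow> opair E x \<beta> \<in> elts E t"
      by simp
    also have "\<dots> \<longleftrightarrow> E x X \<and> E \<beta> \<alpha> \<and>
        (\<exists>\<eta> s. rel f x \<eta> \<and> E \<eta> \<xi> \<and> approx s \<eta> \<and> least_unused s x \<beta>)"
      unfolding t by (simp add: elts_cprod del: in_elts)
    \<comment> \<open>A candidate already has x in X and \<beta> in \<alpha>, so separating t from
      the product loses no pair.\<close>
    also have "\<dots> \<longleftrightarrow> (\<exists>\<eta> s. rel f x \<eta> \<and> E \<eta> \<xi> \<and> approx s \<eta> \<and> least_unused s x \<beta>)"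
      unfolding least_unused_def candidate_def by blast
    finally show ?thesis .
  qed
  have trans': "\<And>a b. \<lbrakk>E b \<eta>; E a b\<rbrakk> \<Longrightarrow> E a \<eta>" if "E \<eta> \<xi>" for \<eta>
    using ordinal_elem_trans[OF ordinal_\<kappa> sub[OF that]] .
  \<comment> \<open>The value prescribed at x is the same for every approximation reaching at least
    up to f(x).\<close>
  have least_unused_eq: "least_unused s x \<beta> \<longleftrightarrow> least_unused s' x \<beta>"
    if "rel f x \<eta>" "E \<eta> \<xi>" "E \<theta> \<xi>" "\<eta> = \<theta> \<or> E \<eta> \<theta>" "approx s \<eta>" "approx s' \<theta>" for x \<beta> \<eta> \<theta> s s'
  proof (rule least_unused_cong)
    fix y \<gamma> assume "lower y x"
    then have "below y \<eta>"
      using that(1) rel_f_unique unfolding lower_def by blast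
    moreover from this have "below y \<theta>"
      using that(4) trans'[OF that(3)] unfolding below_def by blast
    ultimately show "rel s y \<gamma> \<longleftrightarrow> rel s' y \<gamma>"
      by (intro approx_agree[OF that(5,6)]) (use trans'[OF that(2)] trans'[OF that(3)] in blast)+
  qed
  have rel_t_iff: "rel t x \<beta> \<longleftrightarrow> least_unused s x \<beta>"
    if "rel f x \<eta>" "E \<eta> \<xi>" "approx s \<eta>" for x \<beta> \<eta> s
    unfolding rel_t using that least_unused_eq[of x \<eta> \<eta>] rel_f_unique[of x] by blast
  have least_unused_t: "least_unused t x \<beta> \<longleftrightarrow> least_unused s x \<beta>"
    if x: "rel f x \<eta>" "E \<eta> \<xi>" and s: "approx s \<eta>" for x \<beta> \<eta> s
  proof (rule least_unused_cong)
    fix y \<gamma> assume "lower y x"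
    then obtain \<upsilon> where \<upsilon>: "rel f y \<upsilon>" "E \<upsilon> \<eta>"
      using x(1) rel_f_unique unfolding lower_def below_def by blast
    moreover have "E \<upsilon> \<xi>"
      using \<upsilon>(2) x(2) trans by blast
    \<comment> \<open>The value of t at y comes from an approximation r up to f(y); comparing r with
      the longer s shows that t and s agree at y.\<close>
    moreover obtain r where "approx r \<upsilon>"
      using ex[OF \<open>E \<upsilon> \<xi>\<close>] by blast
    ultimately have "rel t y \<gamma> \<longleftrightarrow> least_unused s y \<gamma>"
      using rel_t_iff least_unused_eq[of y \<upsilon> \<eta>] x(2) s by blast
    moreover have "below y \<eta>"
      using \<upsilon> unfolding below_def by blast
    ultimately show "rel t y \<gamma> \<longleftrightarrow> rel s y \<gamma>"
      using s unfolding approx_def by blast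
  qed
  have "rel t x \<beta> \<longleftrightarrow> below x \<xi> \<and> least_unused t x \<beta>" for x \<beta>
  proof (cases "below x \<xi>")
    case True
    then obtain \<eta> s where x: "rel f x \<eta>" "E \<eta> \<xi>" "approx s \<eta>"
      unfolding below_def using ex by blast
    show ?thesis
      using rel_t_iff[OF x] least_unused_t[OF x] True by simp
  next
    case False
    then show ?thesis
      unfolding rel_t below_def by blast
  qed
  moreover have "elts E t \<subseteq> elts E (cprod E X \<alpha>)"
    unfolding t by blast
  ultimately show ?thesis
    unfolding approx_def by blast
qed

lemma ex_approx: "E \<xi> \<kappa> \<Longrightarrow> \<exists>t. approx t \<xi>"
proof (rule ccontr)
  let ?\<phi> = "Neg (fEx 9 (fApprox 9 0))"
  have sat: "sat E ((env X X X X)(0 := \<xi>)) ?\<phi> \<longleftrightarrow> \<not> (\<exists>t. approx t \<xi>)" for \<xi>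
    by simp
  assume "E \<xi> \<kappa>" "\<not> (\<exists>t. approx t \<xi>)"
  then obtain \<eta> where \<eta>: "E \<eta> \<kappa>" "\<not> (\<exists>t. approx t \<eta>)"
    and least: "\<And>b. E b \<eta> \<Longrightarrow> \<not> \<not> (\<exists>t. approx t b)"
    using ordinal_least[of \<kappa> \<xi> "env X X X X" ?\<phi>, unfolded sat, OF ordinal_\<kappa>] by blast
  have "\<exists>t. approx t \<eta> \<and> elts E t \<subseteq> elts E (cprod E X \<alpha>)"
    by (rule approx_step) (use least ordinal_trans[OF ordinal_\<kappa> \<eta>(1)]
      ordinal_elem_trans[OF ordinal_\<kappa> \<eta>(1)] in blast)+
  then show False
    using \<eta>(2) by blast
qed

text \<open>One more step, at \<kappa> itself: every f-value lies in \<kappa>, so the domain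
  restriction of \<open>approx\<close> disappears.\<close>

lemma ex_greedy:
  obtains t where "elts E t \<subseteq> elts E (cprod E X \<alpha>)"
    and "\<And>x \<beta>. rel t x \<beta> \<longleftrightarrow> least_unused t x \<beta>"
proof -
  have "\<exists>t. approx t \<kappa> \<and> elts E t \<subseteq> elts E (cprod E X \<alpha>)"
    by (rule approx_step) (use ex_approx ordinal_trans[OF ordinal_\<kappa>] in blast)+
  then obtain t where t: "approx t \<kappa>" "elts E t \<subseteq> elts E (cprod E X \<alpha>)"
    by blast
  have "below x \<kappa>" if "E x X" for x
    using that app_eq[OF fun_f] range_f unfolding below_def by blast
  then have "rel t x \<beta> \<longleftrightarrow> least_unused t x \<beta>" for x \<beta>
    using t(1) unfolding approx_def least_unused_def candidate_def by blast
  with t(2) show ?thesis using that by blast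
qed

section \<open>Properties of the greedy function\<close>

lemma greedy_unique:
  assumes t: "\<And>x \<beta>. rel t x \<beta> \<longleftrightarrow> least_unused t x \<beta>" and "rel t x \<beta>" "rel t x \<gamma>"
  shows "\<beta> = \<gamma>"
proof -
  have "\<not> E \<gamma>' \<beta>'" if "least_unused t x \<beta>'" "least_unused t x \<gamma>'" for \<beta>' \<gamma>'
    using that unfolding least_unused_def by blast
  moreover have "E \<beta> \<alpha>" "E \<gamma> \<alpha>"
    using assms(2,3)[unfolded t] unfolding least_unused_def candidate_def by blast+
  ultimately show ?thesis
    using ordinal_linear[OF ordinal_\<alpha>] assms(2,3)[unfolded t] by blast
qed

text \<open>If the f-values differed, the point of smaller f-value would block \<beta> at the other.
  Hence constancy of the greedy function passes to f.\<close>

lemma greedy_separates: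
  assumes t: "\<And>x \<beta>. rel t x \<beta> \<longleftrightarrow> least_unused t x \<beta>" and "rel t x \<beta>" "rel t y \<beta>"
    and "rel f x u" "rel f y v"
  shows "u = v"
proof -
  have "\<not> lower y x" "\<not> lower x y"
    using assms(2,3) assms(2,3)[unfolded t] unfolding least_unused_def by blast+
  then show ?thesis
    using ordinal_linear[OF ordinal_\<kappa>, of u v] range_f assms(4,5)
    unfolding lower_def below_def by blast
qed

lemma greedy_exhausts:
  assumes t: "\<And>x \<beta>. rel t x \<beta> \<longleftrightarrow> least_unused t x \<beta>" and x: "\<not> (\<exists>\<gamma>. rel t x \<gamma>)"
    and \<beta>: "candidate x \<beta>"
  shows "\<exists>y. rel t y \<beta>"
proof (rule ccontr)
  let ?\<phi> = "Conj (fCandidate 6 0) (Neg (fUsed 5 6 0))"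
  have sat: "sat E ((env t x x x)(0 := \<beta>)) ?\<phi> \<longleftrightarrow>
      candidate x \<beta> \<and> \<not> (\<exists>y. lower y x \<and> rel t y \<beta>)" for \<beta>
    by simp
  assume "\<not> (\<exists>y. rel t y \<beta>)"
  then have "sat E ((env t x x x)(0 := \<beta>)) ?\<phi>"
    unfolding sat using \<beta> by blast
  moreover have "E \<beta> \<alpha>"
    using \<beta> unfolding candidate_def by blast
  ultimately obtain \<gamma> where "sat E ((env t x x x)(0 := \<gamma>)) ?\<phi>"
    and "\<And>b. E b \<gamma> \<Longrightarrow> \<not> sat E ((env t x x x)(0 := b)) ?\<phi>"
    using ordinal_least[OF ordinal_\<alpha>] by blast
  then have "least_unused t x \<gamma>"
    unfolding least_unused_def sat by blast
  then show False
    using x unfolding t by blast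
qed

end

section \<open>The greedy choice is onto\<close>

context ZF_model
begin

text \<open>Ultrapower classes consist of functions total on X, so the partial function is extended
  by the default value a.\<close>

lemma ex_total_extension:
  assumes t: "elts E t \<subseteq> elts E (cprod E X \<alpha>)"
    and unique: "\<And>x y z. \<lbrakk>rel t x y; rel t x z\<rbrakk> \<Longrightarrow> y = z" and a: "E a \<alpha>"
  shows "\<exists>h. fun_on E X h \<and> (\<forall>x y. rel t x y \<longrightarrow> E x X \<and> app E h x = y)"
proof -
  \<comment> \<open>Variable 2 is not updated, so in this assignment it denotes a.\<close>
  obtain h where h: "elts E h = {p \<in> elts E (cprod E X \<alpha>). sat E ((\<lambda>_. a)(1 := t, 0 := p))
      (fDisj (Mem 0 1) (fEx 3 (Conj (fPair 0 3 2) (Neg (fEx 4 (fRel 1 3 4))))))}"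
    using separation by blast
  have mem_h: "E p h \<longleftrightarrow> p \<in> elts E (cprod E X \<alpha>) \<and>
      (E p t \<or> (\<exists>x. p = opair E x a \<and> \<not> (\<exists>y. rel t x y)))" for p
  proof -
    have "E p h \<longleftrightarrow> p \<in> elts E h" by simp
    then show ?thesis unfolding h by simp
  qed
  have dom: "E x X \<and> E y \<alpha>" if "rel t x y" for x y
  proof -
    have "opair E x y \<in> elts E (cprod E X \<alpha>)" using t that by auto
    then show ?thesis unfolding elts_cprod by auto
  qed
  have rel_h: "rel h x y \<longleftrightarrow> E x X \<and> (rel t x y \<or> y = a \<and> \<not> (\<exists>y. rel t x y))" for x y
    unfolding mem_h elts_cprod using dom a by auto
  have h_fun: "fun_on E X h"
    unfolding fun_on_def
  proof (intro conjI allI impI)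
    show "\<exists>x y. E x X \<and> p = opair E x y" if "E p h" for p
      using that unfolding mem_h elts_cprod by blast
    show "\<exists>!y. rel h x y" if "E x X" for x
      unfolding rel_h using that unique by blast
  qed
  then show ?thesis
    using app_eq[OF h_fun] rel_h dom by blast
qed

lemma surj_le_of_image_in_ultrapower:
  assumes U: "ultrafilter_over E X U" and \<kappa>: "ordinal E \<kappa>" and nonconst: "has_nonconstant_fun E X U \<kappa>"
    and \<alpha>: "ordinal E \<alpha>" and img: "image_in_ultrapower E X U \<alpha>"
  shows "surj_le E \<alpha> X"
proof -
  obtain f where f: "fun_on E X f" "\<And>x. E x X \<Longrightarrow> E (app E f x) \<kappa>"
    and f_nonconst: "\<And>A c. E A U \<Longrightarrow> \<exists>x. E x A \<and> app E f x \<noteq> c"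
    using nonconst unfolding has_nonconstant_fun_def by blast
  obtain g where g: "fun_on E X g"
    and g_img: "\<And>f. fun_on E X f \<Longrightarrow> ult_mem E X U (ult_class E X U f) (ult_class E X U g) \<longleftrightarrow>
        (\<exists>\<beta>. E \<beta> \<alpha> \<and> ult_class E X U f = ult_embed E X U \<beta>)"
    using img unfolding image_in_ultrapower_def by blast
  have "E u \<kappa>" if "rel f x u" for x u
    using f(2) that app_eq[OF f(1)] fun_on_domain[OF f(1)] by metis
  then interpret greedy_choice E X \<kappa> \<alpha> f g
    by unfold_locales (use \<kappa> \<alpha> f(1) in auto)
  obtain t where t_sub: "elts E t \<subseteq> elts E (cprod E X \<alpha>)"
    and t: "\<And>x \<beta>. rel t x \<beta> \<longleftrightarrow> least_unused t x \<beta>"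
    using ex_greedy by blast
  note unique = greedy_unique[OF t]
  obtain D where "elts E D = {x \<in> elts E X. sat E ((\<lambda>_. t)(0 := x)) (fEx 2 (fRel 1 0 2))}"
    using separation by blast
  then have D: "elts E D = {x. E x X \<and> (\<exists>\<beta>. rel t x \<beta>)}"
    by simp
  have D_iff: "E x D \<longleftrightarrow> E x X \<and> (\<exists>\<beta>. rel t x \<beta>)" for x
    using D unfolding elts_def by blast
  have "\<exists>x. rel t x \<beta>" if \<beta>: "E \<beta> \<alpha>" for \<beta>
  proof -
    have "elts E D \<subseteq> elts E X"
      unfolding D by auto
    then consider "E D U" | B where "E B U" "elts E B = elts E X - elts E D"
      by (rule ultrafilter_cases[OF U])
    then show ?thesis
    proof cases
      case 1
      \<comment> \<open>This case is contradictory. The fixed \<beta> only serves as the default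
        value off D, which is why the split is made for each \<beta> separately.\<close>
      obtain h where h: "fun_on E X h" "\<And>x y. rel t x y \<Longrightarrow> app E h x = y"
        using ex_total_extension[OF t_sub _ \<beta>] unique by blast
      have "E (app E h x) (app E g x)" if "E x D" for x
      proof -
        obtain \<gamma> where \<gamma>: "rel t x \<gamma>" "E x X"
          using \<open>E x D\<close> unfolding D_iff by blast
        obtain u where "rel g x u" "E \<gamma> u"
          using \<gamma>(1)[unfolded t] unfolding least_unused_def candidate_def by blast
        then show ?thesis
          using h(2)[OF \<gamma>(1)] app_eq[OF g \<gamma>(2), of u] by simp
      qed
      then obtain A \<gamma> where A: "E A U" "\<And>x. E x A \<Longrightarrow> E x X \<and> app E h x = \<gamma>"
        using selector_constant[OF U g g_img h(1) 1] by blast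
      \<comment> \<open>Intersecting with D is essential: only there does h carry a value of the
        greedy function and not the default.\<close>
      obtain B where B: "E B U" "elts E B = elts E A \<inter> elts E D"
        using ultrafilter_Int[OF U A(1) 1] by blast
      have B_rel: "E x X \<and> rel t x \<gamma>" if "E x B" for x
      proof -
        have "x \<in> elts E B" using that by simp
        then have "E x A" "E x D" unfolding B(2) by simp_all
        then show ?thesis
          using A(2) h(2) unfolding D_iff by blast
      qed
      obtain b where b: "E b B"
        using ultrafilter_nonempty[OF U B(1)] by blast
      have "app E f x = app E f b" if "E x B" for x
        using greedy_separates[OF t, of x \<gamma> b] B_rel[OF that] B_rel[OF b] app_eq[OF f(1)] by blast
      then show ?thesis
        using f_nonconst[OF B(1)] by blast
    next
      case (2 B)
      obtain A where A: "E A U" "\<And>x. E x A \<Longrightarrow> E x X \<and> E \<beta> (app E g x)"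
        using image_covers[OF U g g_img \<beta>] by blast
      \<comment> \<open>A point of this intersection has \<beta> as a candidate but receives no
        value.\<close>
      obtain C where C: "E C U" "elts E C = elts E A \<inter> elts E B"
        using ultrafilter_Int[OF U A(1) 2(1)] by blast
      obtain x where "E x C"
        using ultrafilter_nonempty[OF U C(1)] by blast
      then have "x \<in> elts E C" by simp
      then have x: "E x A" "E x X" "\<not> (\<exists>\<gamma>. rel t x \<gamma>)"
        unfolding C(2) 2(2) D by auto
      have "candidate x \<beta>"
        unfolding candidate_def using A(2)[OF x(1)] \<beta> app_eq[OF g x(2)] by blast
      then show ?thesis
        using greedy_exhausts[OF t x(3)] by blast
    qed
  qed
  moreover have "\<exists>x y. E x X \<and> E y \<alpha> \<and> p = opair E x y" if "E p t" for p
  proof -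
    have "p \<in> elts E (cprod E X \<alpha>)" using t_sub that by auto
    then show ?thesis unfolding elts_cprod by blast
  qed
  ultimately show ?thesis
    unfolding surj_le_def using unique by (intro exI[of _ t]) blast
qed

end

theorem mainTheorem12:
  fixes E :: "'v \<Rightarrow> 'v \<Rightarrow> bool" and X U \<kappa> \<alpha> :: 'v
  assumes "ZF_model E"
    and "surj_le E (cprod E X X) X"
    and "ultrafilter_over E X U"
    and "critical_point E X U \<kappa>"
    and "ordinal E \<alpha>"
    and "ord_le E \<kappa> \<alpha>"
    and "image_in_ultrapower E X U \<alpha>"
  shows "surj_le E \<alpha> X"
proof -
  have "ordinal E \<kappa>" "has_nonconstant_fun E X U \<kappa>"
    using assms(4) unfolding critical_point_def by blast+
  then show ?thesis
    using ZF_model.surj_le_of_image_in_ultrapower[OF assms(1,3)] assms(5,7) by blast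
qed

end
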